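(* Let $S$ be a locally porous relative Schottky set in a domain $D\subseteq\mathbb{C}$, and let $U\subseteq D$ be an open set such that $S\cap U$ is connected. Let $f,g\colon S\cap U\to\tilde S$ be Schottky maps into a relative Schottky set $\tilde S$ in a domain $\tilde D\subseteq\mathbb{C}$, and let $$E=\{p\in S\cap U : f(p)=g(p)\}.$$ If $E$ has an accumulation point in $U$, then $E=S\cap U$.
   Context: A domain is an open connected subset of $\mathbb{C}$. A relative Schottky set in a domain $D\subseteq\mathbb{C}$ is a set of the form $S=D\setminus\bigcup_{i\in I}B_i$, where each $B_i$ is an open round disc with closure $\overline{B_i}\subseteq D$ and $\overline{B_i}\cap\overline{B_j}=\emptyset$ for $i\ne j$. If $D=\mathbb{C}$, the set $S$ is called a Schottky set, and in this case some $B_i$ are also allowed to be open half-planes. The relative Schottky set $S$ is locally porous at $p\in S$ if there exist a neighborhood $W$ of $p$ and constants $r_0>0$, $C\ge1$ such that for every $q\in S\cap W$ and every $0<r\le r_0$ there is $i\in I$ with $B(q,r)\cap B_i\neq\emptyset$ and $r/C\le\operatorname{diam}(B_i)\le Cr$, where $B(q,r)$ is the open disc of center $q$ and radius $r$. $S$ is locally porous if it is locally porous at every $p\in S$. Let $S$ and $\tilde S$ be relative Schottky sets in domains $D$ and $\tilde D$, and let $U\subseteq D$ be open. A map $f\colon S\cap U\to\tilde S$ is a local homeomorphism if for every $p\in S\cap U$ there is an open set $V\ni p$ such that $f(S\cap U\cap V)$ is open in $\tilde S$ and $f\colon S\cap U\cap V\to f(S\cap U\cap V)$ is a homeomorphism.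 Such a map $f$ is conformal at $p\in S\cap U$ if the limit $f'(p)=\lim_{q\in S,\,q\to p}\frac{f(q)-f(p)}{q-p}$ exists and is non-zero. A Schottky map $f\colon S\cap U\to\tilde S$ is a local homeomorphism that is conformal at every point of $S\cap U$ and whose derivative $f'$ is continuous on $S\cap U$. *)

theory Defs
  imports "HOL-Analysis.Analysis"
begin

definition is_domain :: "complex set \<Rightarrow> bool" where
  "is_domain D \<longleftrightarrow> open D \<and> connected D"

definition open_disc :: "complex set \<Rightarrow> bool" where
  "open_disc B \<longleftrightarrow> (\<exists>c r. 0 < r \<and> B = ball c r)"

definition open_half_plane :: "complex set \<Rightarrow> bool" where
  "open_half_plane B \<longleftrightarrow> (\<exists>a b. a \<noteq> 0 \<and> B = {z. a \<bullet> z < b})"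

text \<open>
  The family \<open>(B i)\<close>, \<open>i \<in> I\<close>, is kept as a parameter since porosity refers to it; it is determined
  by \<open>S\<close> and \<open>D\<close> up to reindexing, as the \<open>B i\<close> are the components of \<open>D - S\<close>.  All closures are
  taken in the plane, also for half-planes, so that two of
  the \<open>B i\<close> may be half-planes with parallel boundary lines.
\<close>

definition relative_schottky_set ::
    "complex set \<Rightarrow> 'i set \<Rightarrow> ('i \<Rightarrow> complex set) \<Rightarrow> complex set \<Rightarrow> bool" where
  "relative_schottky_set D I B S \<longleftrightarrow>
     is_domain D \<and>
     (\<forall>i\<in>I. open_disc (B i) \<or> (D = UNIV \<and> open_half_plane (B i))) \<and>
     (\<forall>i\<in>I. closure (B i) \<subseteq> D) \<and>
     (\<forall>i\<in>I. \<forall>j\<in>I. i \<noteq> j \<longrightarrow> closure (B i) \<inter> closure (B j) = {}) \<and>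
     S = D - (\<Union>i\<in>I. B i)"

text \<open>
  The boundedness condition excludes half-planes, whose diameter is infinite, whereas \<^const>\<open>diameter\<close>
  is real-valued and unspecified on unbounded sets.
\<close>

definition locally_porous_at ::
    "'i set \<Rightarrow> ('i \<Rightarrow> complex set) \<Rightarrow> complex set \<Rightarrow> complex \<Rightarrow> bool" where
  "locally_porous_at I B S p \<longleftrightarrow>
     (\<exists>W r0 C. open W \<and> p \<in> W \<and> 0 < r0 \<and> 1 \<le> C \<and>
        (\<forall>q\<in>S \<inter> W. \<forall>r. 0 < r \<and> r \<le> r0 \<longrightarrow>
           (\<exists>i\<in>I. ball q r \<inter> B i \<noteq> {} \<and> bounded (B i) \<and>
                  r / C \<le> diameter (B i) \<and> diameter (B i) \<le> C * r)))"

definition locally_porous :: "'i set \<Rightarrow> ('i \<Rightarrow> complex set) \<Rightarrow> complex set \<Rightarrow> bool" where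
  "locally_porous I B S \<longleftrightarrow> (\<forall>p\<in>S. locally_porous_at I B S p)"

text \<open>
  In what follows \<open>A\<close> plays the role of \<open>S \<inter> U\<close>.  As \<open>U\<close> is open, limits along \<open>q \<in> S\<close> at a point of
  \<open>S \<inter> U\<close> are limits within \<open>S \<inter> U\<close>; nothing depends on the values of \<open>f\<close> outside \<open>A\<close>.
\<close>

definition local_homeomorphism ::
    "complex set \<Rightarrow> complex set \<Rightarrow> (complex \<Rightarrow> complex) \<Rightarrow> bool" where
  "local_homeomorphism A T f \<longleftrightarrow>
     f ` A \<subseteq> T \<and>
     (\<forall>p\<in>A. \<exists>V. open V \<and> p \<in> V \<and>
        openin (top_of_set T) (f ` (A \<inter> V)) \<and>
        (\<exists>h. homeomorphism (A \<inter> V) (f ` (A \<inter> V)) f h))"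

definition conformal_at :: "complex set \<Rightarrow> (complex \<Rightarrow> complex) \<Rightarrow> complex \<Rightarrow> bool" where
  "conformal_at A f p \<longleftrightarrow>
     (\<exists>l. l \<noteq> 0 \<and> ((\<lambda>q. (f q - f p) / (q - p)) \<longlongrightarrow> l) (at p within A))"

text \<open>
  The limit is unique at every point of a relatively open subset of a relative Schottky set, since
  such a set has no isolated points.
\<close>

definition schottky_deriv :: "complex set \<Rightarrow> (complex \<Rightarrow> complex) \<Rightarrow> complex \<Rightarrow> complex" where
  "schottky_deriv A f p = Lim (at p within A) (\<lambda>q. (f q - f p) / (q - p))"

definition schottky_map ::
    "complex set \<Rightarrow> complex set \<Rightarrow> (complex \<Rightarrow> complex) \<Rightarrow> bool" where
  "schottky_map A T f \<longleftrightarrow>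
     local_homeomorphism A T f \<and>
     (\<forall>p\<in>A. conformal_at A f p) \<and>
     continuous_on A (schottky_deriv A f)"

end

theory Submission
  imports Defs
begin

text \<open>
  The set of points near which \<open>f = g\<close> is open in \<open>S \<inter> U\<close> by definition, so by connectedness it is
  enough that every accumulation point \<open>p \<in> S \<inter> U\<close> of the coincidence set has a neighborhood on
  which \<open>f = g\<close> (\<open>schottky_maps_agree_near\<close>). Two facts give this.

  A relative Schottky set is locally quasiconvex: where a segment between two of its points crosses
  a disc \<open>B i\<close>, the chord can be replaced by the shorter boundary arc. Integrating \<open>f'\<close> along such
  curves turns the continuity of \<open>f'\<close> into strict differentiability: with \<open>l = f' p\<close>,
  \<open>|f y - f x - l (y - x)| \<le> \<epsilon> |y - x|\<close>
  for all \<open>x, y \<in> S\<close> close to \<open>p\<close> (\<open>schottky_map_strict_derivative\<close>). Such curves need not be built from their arcs: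
  a mean value inequality on a closed set of parameters (\<open>mean_value_with_gaps\<close>) only asks for a
  bound across every gap, that is, across every chord, where it follows from the inequality along
  an arc.

  At an accumulation point \<open>p\<close> of the coincidence set, \<open>f\<close> and \<open>g\<close> have the same value and the same
  derivative \<open>l\<close>, so \<open>f - g\<close> has a small Lipschitz constant near \<open>p\<close>. Suppose that
  \<open>f q \<noteq> g q\<close> for some \<open>q\<close> close to \<open>p\<close>, and put \<open>v = (f q - g q) / l\<close> and \<open>d = |v|\<close>. Up to
  an error \<open>o(d)\<close>, the partial map \<open>f\<^sup>-\<^sup>1 \<circ> g\<close> is the translation by \<open>-v\<close> on the scale \<open>d\<close> around \<open>q\<close>.
  Porosity provides a disc \<open>B i\<close> near \<open>q\<close> whose size is comparable with \<open>d\<close> and whose radius is at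
  least \<open>2 d\<close>. The translation moves the boundary point of \<open>B i\<close> with outward normal \<open>v\<close> into \<open>B i\<close>,
  to depth about \<open>d\<close>, and the error cannot bring it back to \<open>S\<close>. But \<open>f\<^sup>-\<^sup>1 \<circ> g\<close> takes values in \<open>S\<close>,
  because \<open>f\<close> maps onto a neighborhood of \<open>f p\<close> in the target.
\<close>

section \<open>A mean value inequality across gaps\<close>

text \<open>
  The parameters up to which the bound holds throughout \<open>T\<close> form a set that contains its
  supremum \<open>m\<close>. If \<open>m < b\<close>, then either \<open>T\<close> accumulates at \<open>m\<close> from the right, and the local bound
  at \<open>m\<close> leads beyond \<open>m\<close>, or \<open>m\<close> is the left end of a gap, and the bound across the gap does.
\<close>

lemma mean_value_with_gaps:
  fixes u :: "real \<Rightarrow> 'a::real_normed_vector"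
  assumes T: "closed T" "a \<in> T" "b \<in> T" "a \<le> b"
    and cont: "continuous_on (T \<inter> {a..b}) u"
    and right: "\<And>t. t \<in> T \<Longrightarrow> a \<le> t \<Longrightarrow> t < b \<Longrightarrow>
      \<exists>d>0. \<forall>s\<in>T. t < s \<and> s < t + d \<and> s \<le> b \<longrightarrow> norm (u s - u t) \<le> K * (s - t)"
    and gap: "\<And>s t. s \<in> T \<Longrightarrow> t \<in> T \<Longrightarrow> a \<le> s \<Longrightarrow> s < t \<Longrightarrow> t \<le> b \<Longrightarrow>
      {s<..<t} \<inter> T = {} \<Longrightarrow> norm (u t - u s) \<le> K * (t - s)"
  shows "norm (u b - u a) \<le> K * (b - a)"
proof -
  define H where "H = {t \<in> T \<inter> {a..b}. norm (u t - u a) \<le> K * (t - a)}"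
  define G where "G = {t \<in> T \<inter> {a..b}. T \<inter> {a..t} \<subseteq> H}"
  define m where "m = Sup G"
  have clT: "closed (T \<inter> {a..b})"
    using T by auto
  have clH: "closed H"
    unfolding H_def by (intro continuous_closed_preimage_constant continuous_on_closed_Collect_le continuous_intros cont clT)
  have aG: "a \<in> G"
    using T by (auto simp: G_def H_def)
  have bdd: "bdd_above G"
    by (rule bdd_aboveI[of _ b]) (auto simp: G_def)
  have GH: "G \<subseteq> H"
    by (auto simp: G_def)
  have mH: "m \<in> H"
    using closure_contains_Sup[of G] aG bdd closure_minimal[OF GH clH] unfolding m_def by auto
  have below: "s \<in> H" if "s \<in> T" "a \<le> s" "s < m" for s
    using that less_cSup_iff[of G s] aG bdd unfolding m_def G_def by fastforce
  have mG: "m \<in> G"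
    using mH below by (force simp: G_def H_def)
  \<comment> \<open>Every further point of \<open>T\<close> that satisfies the bound relative to \<open>m\<close> satisfies it relative to \<open>a\<close>.\<close>
  have step: "s \<in> H" if "s \<in> T" "m < s" "s \<le> b" "norm (u s - u m) \<le> K * (s - m)" for s
  proof -
    have "norm (u s - u a) \<le> norm (u s - u m) + norm (u m - u a)"
      using norm_triangle_ineq[of "u s - u m" "u m - u a"] by simp
    also have "\<dots> \<le> K * (s - m) + K * (m - a)"
      using that mH by (auto simp: H_def)
    finally show ?thesis
      using that mH by (auto simp: H_def algebra_simps)
  qed
  have ext: "s \<notin> G" if "m < s" for s
    using that cSup_upper[OF _ bdd, of s] unfolding m_def by auto
  have "m = b"
  proof (rule ccontr)
    assume "m \<noteq> b"
    with mH have mb: "m < b" "a \<le> m" "m \<in> T"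
      by (auto simp: H_def)
    obtain d where d: "d > 0"
      "\<And>s. s \<in> T \<Longrightarrow> m < s \<Longrightarrow> s < m + d \<Longrightarrow> s \<le> b \<Longrightarrow> norm (u s - u m) \<le> K * (s - m)"
      using right[OF mb(3,2,1)] by blast
    show False
    proof (cases "\<exists>s\<in>T. m < s \<and> s < m + d \<and> s \<le> b")
      case True
      then obtain s where s: "s \<in> T" "m < s" "s < m + d" "s \<le> b"
        by blast
      have "s' \<in> H" if "s' \<in> T" "a \<le> s'" "s' \<le> s" for s'
        using that s d(2)[of s'] step[of s'] below[of s'] mH by (cases s' m rule: linorder_cases) auto
      with s mb have "s \<in> G"
        by (auto simp: G_def)
      with ext s show False
        by blast
    next
      case False
      define N where "N = T \<inter> {m + d..b}"
      define n where "n = Inf N"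
      have N: "s \<in> N" if "s \<in> T" "m < s" "s \<le> b" for s
        using that False by (force simp: N_def)
      have "closed N" "b \<in> N" "bdd_below N"
        using T N[of b] mb by (auto simp: N_def)
      then have n: "n \<in> N" "\<And>s. s \<in> N \<Longrightarrow> n \<le> s"
        using closed_contains_Inf[of N] cInf_lower[of _ N] unfolding n_def by auto
      have nT: "n \<in> T" "m < n" "n \<le> b"
        using n(1) d(1) by (auto simp: N_def)
      have none: "n \<le> s" if "s \<in> T" "m < s" "s \<le> b" for s
        using n(2) N that by blast
      have "norm (u n - u m) \<le> K * (n - m)"
        using none nT by (intro gap mb nT) force
      then have "n \<in> H"
        by (intro step nT)
      have "s' \<in> H" if "s' \<in> T" "a \<le> s'" "s' \<le> n" for s'
        using that nT none[of s'] \<open>n \<in> H\<close> below[of s'] mH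
        by (cases s' m rule: linorder_cases) auto
      with nT mb have "n \<in> G"
        by (auto simp: G_def)
      with ext nT show False
        by blast
    qed
  qed
  with mH show ?thesis
    by (simp add: H_def)
qed

section \<open>Circular arcs and chords\<close>

lemma norm_cis_minus_1: "norm (cis t - 1) = 2 * \<bar>sin (t / 2)\<bar>"
  using dist_exp_i_1[of t] by (simp add: cis_conv_exp)

lemma norm_cis_diff_le: "norm (cis s - cis t) \<le> \<bar>s - t\<bar>"
proof -
  have "cis s - cis t = cis t * (cis (s - t) - 1)"
    by (simp add: cis_mult right_diff_distrib)
  then show ?thesis
    using abs_sin_x_le_abs_x[of "(s - t) / 2"] by (simp add: norm_mult norm_cis_minus_1)
qed

lemma angle_le_chord:
  assumes "\<bar>t\<bar> \<le> pi"
  shows "\<bar>t\<bar> \<le> 3 * norm (cis t - 1)"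
proof -
  define x where "x = t / 2"
  \<comment> \<open>On \<open>\<bar>x\<bar> \<le> 2\<close> the cubic error of \<open>sin x \<approx> x\<close> is at most \<open>2 / 3 * \<bar>x\<bar>\<close>, which costs the factor 3.\<close>
  have "\<bar>x\<bar> \<le> 2"
    using assms pi_less_4 by (simp add: x_def)
  then have "\<bar>x\<bar>\<^sup>2 \<le> 2\<^sup>2"
    by (intro power_mono) auto
  then have "\<bar>x\<bar> ^ 3 \<le> 4 * \<bar>x\<bar>"
    by (simp add: power3_eq_cube power2_eq_square mult_right_mono)
  moreover have "\<bar>sin x - x\<bar> \<le> \<bar>x\<bar> ^ 3 / 6"
  proof -
    have "(\<Sum>m<3. sin_coeff m * x ^ m) = x"
      by (simp add: eval_nat_numeral sin_coeff_def)
    moreover have "(fact 3 :: real) = 6"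
      by (simp add: fact_numeral)
    ultimately show ?thesis
      using Maclaurin_sin_bound[of x 3] by (simp only: divide_inverse mult.commute)
  qed
  ultimately have "\<bar>x\<bar> \<le> 3 * \<bar>sin x\<bar>"
    by linarith
  then show ?thesis
    by (simp add: norm_cis_minus_1 x_def)
qed

text \<open>
  The rotation of smallest angle about \<open>c\<close> that takes \<open>a\<close> to \<open>b\<close> follows the shorter of the two arcs,
  so the length of its path is at most three times that of the chord.
\<close>

lemma sphere_arc:
  fixes a b c :: complex
  assumes "norm (a - c) = r" "norm (b - c) = r" "r > 0"
  obtains \<theta> where "b = c + (a - c) * cis \<theta>" "r * \<bar>\<theta>\<bar> \<le> 3 * norm (b - a)"
proof -
  define w where "w = (b - c) / (a - c)"
  have ac: "a \<noteq> c" and w: "norm w = 1" "w \<noteq> 0"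
    using assms by (auto simp: w_def norm_divide)
  have cw: "cis (Arg w) = w"
    using w cis_Arg[of w] by (simp add: sgn_eq)
  have b: "b = c + (a - c) * cis (Arg w)"
    using ac by (simp add: cw) (simp add: w_def)
  have "norm (b - a) = norm ((a - c) * (cis (Arg w) - 1))"
    by (subst b) (simp add: algebra_simps)
  also have "\<dots> = r * norm (cis (Arg w) - 1)"
    using assms by (simp add: norm_mult)
  finally have "3 * norm (b - a) = r * (3 * norm (cis (Arg w) - 1))"
    by simp
  moreover have "r * \<bar>Arg w\<bar> \<le> r * (3 * norm (cis (Arg w) - 1))"
    using assms Arg_bounded[of w] by (intro mult_left_mono angle_le_chord) auto
  ultimately show ?thesis
    using that[OF b] by simp
qed

section \<open>Functions with pointwise Lipschitz bounds\<close>

text \<open>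
  The bound only compares values with the value at the center \<open>x\<close>, on a neighborhood that depends
  on \<open>x\<close>. This is what a bounded derivative along \<open>Q\<close> gives; a Lipschitz bound on \<open>Q\<close> itself depends
  on the geometry of \<open>Q\<close>.
\<close>

definition pointwise_lipschitz_on :: "real \<Rightarrow> 'a::metric_space set \<Rightarrow> ('a \<Rightarrow> 'b::metric_space) \<Rightarrow> bool"
  where "pointwise_lipschitz_on k Q h \<longleftrightarrow>
    (\<forall>x\<in>Q. \<forall>\<^sub>F y in at x within Q. dist (h y) (h x) \<le> k * dist y x)"

lemma pointwise_lipschitz_onD:
  assumes "pointwise_lipschitz_on k Q h" "x \<in> Q"
  shows "\<exists>d>0. \<forall>y\<in>Q. dist y x < d \<longrightarrow> dist (h y) (h x) \<le> k * dist y x"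
proof -
  have "\<forall>\<^sub>F y in at x within Q. dist (h y) (h x) \<le> k * dist y x"
    using assms unfolding pointwise_lipschitz_on_def by blast
  then obtain d where d: "d > 0"
    "\<And>y. y \<in> Q \<Longrightarrow> y \<noteq> x \<Longrightarrow> dist y x < d \<Longrightarrow> dist (h y) (h x) \<le> k * dist y x"
    unfolding eventually_at by blast
  have "dist (h y) (h x) \<le> k * dist y x" if "y \<in> Q" "dist y x < d" for y
    using d(2)[of y] that by (cases "y = x") simp_all
  with d(1) show ?thesis by blast
qed

lemma pointwise_lipschitz_on_continuous:
  assumes "pointwise_lipschitz_on k Q h"
  shows "continuous_on Q h"
  unfolding continuous_on_def
proof
  fix x assume "x \<in> Q"
  with assms have "\<forall>\<^sub>F y in at x within Q. dist (h y) (h x) \<le> k * dist y x"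
    unfolding pointwise_lipschitz_on_def by blast
  then have "\<forall>\<^sub>F y in at x within Q. norm (dist (h y) (h x)) \<le> norm (dist y x) * k"
    by eventually_elim (simp add: mult.commute)
  moreover have "((\<lambda>y. dist y x) \<longlongrightarrow> 0) (at x within Q)"
    by (rule tendsto_dist_iff[THEN iffD1, OF tendsto_ident_at])
  ultimately have "((\<lambda>y. dist (h y) (h x)) \<longlongrightarrow> 0) (at x within Q)"
    by (rule tendsto_0_le[rotated])
  then show "(h \<longlongrightarrow> h x) (at x within Q)"
    by (rule tendsto_dist_iff[THEN iffD2])
qed

text \<open>
  The path \<open>\<gamma>\<close> may leave the set \<open>Q\<close> on which \<open>h\<close> is controlled, but only at parameters outside \<open>T\<close>.
  For \<open>T = UNIV\<close> there are no gaps, and this is the usual estimate along a curve in \<open>Q\<close>; that case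
  serves for circular arcs, the general one for segments.
\<close>

lemma mean_value_Lipschitz_path_with_gaps:
  fixes h :: "'a::real_normed_vector \<Rightarrow> 'b::real_normed_vector" and \<gamma> :: "real \<Rightarrow> 'a"
  assumes h: "pointwise_lipschitz_on k Q h" and "0 \<le> k" "0 \<le> L"
    and lip: "\<And>s t. norm (\<gamma> s - \<gamma> t) \<le> L * \<bar>s - t\<bar>"
    and T: "closed T" "0 \<in> T" "1 \<in> T" "\<And>t. t \<in> T \<Longrightarrow> 0 \<le> t \<Longrightarrow> t \<le> 1 \<Longrightarrow> \<gamma> t \<in> Q"
    and gap: "\<And>s t. s \<in> T \<Longrightarrow> t \<in> T \<Longrightarrow> 0 \<le> s \<Longrightarrow> s < t \<Longrightarrow> t \<le> 1 \<Longrightarrow>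
      {s<..<t} \<inter> T = {} \<Longrightarrow> norm (h (\<gamma> t) - h (\<gamma> s)) \<le> K * (t - s)"
    and K: "k * L \<le> K"
  shows "norm (h (\<gamma> 1) - h (\<gamma> 0)) \<le> K"
proof -
  have "continuous_on UNIV \<gamma>"
    by (rule lipschitz_on_continuous_on[of L]) (use lip \<open>0 \<le> L\<close> in \<open>auto simp: lipschitz_on_def dist_norm\<close>)
  then have "continuous_on (T \<inter> {0..1}) (\<lambda>t. h (\<gamma> t))"
    using T(4)
    by (intro continuous_on_compose2[OF pointwise_lipschitz_on_continuous[OF h]])
      (auto intro: continuous_on_subset)
  moreover have "\<exists>d>0. \<forall>s\<in>T. t < s \<and> s < t + d \<and> s \<le> 1 \<longrightarrow> norm (h (\<gamma> s) - h (\<gamma> t)) \<le> K * (s - t)"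
    if t: "t \<in> T" "0 \<le> t" "t < 1" for t
  proof -
    obtain d where d: "d > 0" "\<And>y. y \<in> Q \<Longrightarrow> dist y (\<gamma> t) < d \<Longrightarrow> dist (h y) (h (\<gamma> t)) \<le> k * dist y (\<gamma> t)"
      using pointwise_lipschitz_onD[OF h T(4)[of t]] t by auto
    have "norm (h (\<gamma> s) - h (\<gamma> t)) \<le> K * (s - t)"
      if s: "s \<in> T" "t < s" "s < t + d / (L + 1)" "s \<le> 1" for s
    proof -
      have *: "dist (\<gamma> s) (\<gamma> t) \<le> L * (s - t)"
        using lip[of s t] s by (simp add: dist_norm)
      also have "\<dots> \<le> (L + 1) * (s - t)"
        using s by (simp add: algebra_simps)
      also have "\<dots> < d"
        using s \<open>0 \<le> L\<close> by (simp add: field_simps)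
      finally have "norm (h (\<gamma> s) - h (\<gamma> t)) \<le> k * dist (\<gamma> s) (\<gamma> t)"
        using d(2)[of "\<gamma> s"] T(4)[of s] s t by (simp add: dist_norm)
      also have "\<dots> \<le> k * (L * (s - t))"
        using * \<open>0 \<le> k\<close> by (intro mult_left_mono)
      also have "\<dots> \<le> K * (s - t)"
        using K s mult_right_mono[OF K, of "s - t"] by (simp add: mult.assoc)
      finally show ?thesis .
    qed
    then show ?thesis
      using d(1) \<open>0 \<le> L\<close> by (intro exI[of _ "d / (L + 1)"]) auto
  qed
  ultimately have "norm (h (\<gamma> 1) - h (\<gamma> 0)) \<le> K * (1 - 0)"
    using T gap by (intro mean_value_with_gaps[of T 0 1 "\<lambda>t. h (\<gamma> t)" K]) auto
  then show ?thesis by simp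
qed

section \<open>The mean value inequality in a relative Schottky set\<close>

lemma relative_schottky_setD:
  assumes "relative_schottky_set D I B S"
  shows "S = D - (\<Union>i\<in>I. B i)"
    and "i \<in> I \<Longrightarrow> open_disc (B i) \<or> open_half_plane (B i)"
    and "i \<in> I \<Longrightarrow> closure (B i) \<subseteq> D"
    and "i \<in> I \<Longrightarrow> j \<in> I \<Longrightarrow> i \<noteq> j \<Longrightarrow> closure (B i) \<inter> closure (B j) = {}"
    and "i \<in> I \<Longrightarrow> open (B i)"
proof -
  show *: "open_disc (B i) \<or> open_half_plane (B i)" if "i \<in> I"
    using assms that unfolding relative_schottky_set_def by metis
  show "open (B i)" if "i \<in> I"
    using *[OF that] by (auto simp: open_disc_def open_half_plane_def open_halfspace_lt)
qed (use assms in \<open>simp_all add: relative_schottky_set_def\<close>)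

lemma schottky_sphere_subset:
  assumes S: "relative_schottky_set D I B S" and i: "i \<in> I" "B i = ball c r" "0 < r"
  shows "sphere c r \<subseteq> S"
proof
  fix z assume z: "z \<in> sphere c r"
  then have zc: "z \<in> closure (B i)"
    using i by simp
  have "z \<notin> B j" if "j \<in> I" for j
  proof (cases "j = i")
    case True
    with z i show ?thesis by simp
  next
    case False
    then show ?thesis
      using relative_schottky_setD(4)[OF S i(1) that] zc closure_subset[of "B j"] by blast
  qed
  then show "z \<in> S"
    using zc relative_schottky_setD(1)[OF S] relative_schottky_setD(3)[OF S i(1)] by blast
qed

text \<open>
  The open segment is connected and the holes are open and disjoint, so it lies in a single hole,
  with its endpoints on the boundary. The hole is not a half-plane: the segment between
  two points outside a half-plane cannot have its midpoint inside.
\<close>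

lemma schottky_chord:
  assumes S: "relative_schottky_set D I B S"
    and ab: "a \<in> S" "b \<in> S" "a \<noteq> b" "open_segment a b \<subseteq> D - S"
  obtains i c r where "i \<in> I" "B i = ball c r" "0 < r" "a \<in> sphere c r" "b \<in> sphere c r"
proof -
  have Seq: "S = D - (\<Union>i\<in>I. B i)"
    by (rule relative_schottky_setD(1)[OF S])
  define m where "m = midpoint a b"
  have m: "m \<in> open_segment a b"
    using ab by (simp add: m_def)
  obtain i where i: "i \<in> I" "m \<in> B i"
    using m ab(4) Seq by blast
  define R where "R = (\<Union>j\<in>I - {i}. B j)"
  have "B i \<inter> R = {}"
  proof -
    have "B i \<inter> B j = {}" if "j \<in> I - {i}" for j
      using relative_schottky_setD(4)[OF S i(1), of j] that closure_subset[of "B i"] closure_subset[of "B j"]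
      by blast
    then show ?thesis by (auto simp: R_def)
  qed
  moreover have "open_segment a b \<subseteq> B i \<union> R"
    using ab(4) Seq unfolding R_def by blast
  moreover have "open (B i)" "open R"
    using relative_schottky_setD(5)[OF S] i by (auto simp: R_def)
  moreover have "connected (open_segment a b)"
    by (simp add: convex_connected)
  ultimately have "open_segment a b \<inter> R = {}"
    using m i connectedD[of "open_segment a b" "B i" R] by blast
  with \<open>open_segment a b \<subseteq> B i \<union> R\<close> have seg: "open_segment a b \<subseteq> B i"
    by blast
  have nab: "a \<notin> B i" "b \<notin> B i"
    using ab i Seq by auto
  have cl: "a \<in> closure (B i)" "b \<in> closure (B i)"
    using closure_mono[OF seg] ab by (auto simp: closure_open_segment)
  have "\<not> open_half_plane (B i)"
  proof
    assume "open_half_plane (B i)"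
    then obtain n \<beta> where B: "B i = {z. n \<bullet> z < \<beta>}"
      by (auto simp: open_half_plane_def)
    have "n \<bullet> m = (n \<bullet> a + n \<bullet> b) / 2"
      by (simp add: m_def midpoint_def inner_add_right)
    with nab i B show False by auto
  qed
  then obtain c r where B: "B i = ball c r" "0 < r"
    using relative_schottky_setD(2)[OF S i(1)] unfolding open_disc_def by blast
  with nab cl have "a \<in> sphere c r" "b \<in> sphere c r"
    by auto
  with that i B show ?thesis by blast
qed

text \<open>
  This is where the local quasiconvexity of \<open>S\<close> enters. For points of \<open>ball p s\<close> on a common circle,
  the inequality follows from integration along the shorter arc. The arc has length below \<open>6 * s\<close>, which
  explains the ball of radius \<open>7 * s\<close>: it contains the arc even when the disc is much larger than
  \<open>s\<close>. For arbitrary points the segment between them is used, with its chords as gaps.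
\<close>

lemma schottky_mean_value:
  fixes h :: "complex \<Rightarrow> 'b::real_normed_vector"
  assumes S: "relative_schottky_set D I B S"
    and D: "ball p (7 * s) \<subseteq> D" and "0 \<le> k"
    and h: "pointwise_lipschitz_on k (S \<inter> ball p (7 * s)) h"
    and x: "x \<in> S \<inter> ball p s" and y: "y \<in> S \<inter> ball p s"
  shows "norm (h y - h x) \<le> 3 * k * norm (y - x)"
proof -
  define Q where "Q = S \<inter> ball p (7 * s)"
  have hQ: "pointwise_lipschitz_on k Q h"
    using h by (simp add: Q_def)
  have s: "0 < s"
    using x zero_le_dist[of p x] by (auto simp del: zero_le_dist)
  have sub: "ball p s \<subseteq> ball p (7 * s)"
    using s by (intro subset_ball) auto
  have Seq: "S = D - (\<Union>i\<in>I. B i)"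
    by (rule relative_schottky_setD(1)[OF S])
  have circle: "norm (h b - h a) \<le> 3 * k * norm (b - a)"
    if i: "i \<in> I" "B i = ball c r" "0 < r"
      and a: "a \<in> sphere c r" "a \<in> ball p s" and b: "b \<in> sphere c r" "b \<in> ball p s" for i c r a b
  proof -
    obtain \<theta> where \<theta>: "b = c + (a - c) * cis \<theta>" "r * \<bar>\<theta>\<bar> \<le> 3 * norm (b - a)"
      using sphere_arc[of a c r b] a b i by (auto simp: dist_norm norm_minus_commute)
    define \<gamma> where "\<gamma> t = c + (a - c) * cis (t * \<theta>)" for t
    have lip: "norm (\<gamma> t - \<gamma> t') \<le> 3 * norm (b - a) * \<bar>t - t'\<bar>" for t t'
    proof -
      have "norm (\<gamma> t - \<gamma> t') = norm ((a - c) * (cis (t * \<theta>) - cis (t' * \<theta>)))"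
        by (simp add: \<gamma>_def algebra_simps)
      also have "\<dots> = r * norm (cis (t * \<theta>) - cis (t' * \<theta>))"
        using a by (simp add: norm_mult dist_norm norm_minus_commute)
      also have "\<dots> \<le> r * \<bar>t * \<theta> - t' * \<theta>\<bar>"
        using i by (intro mult_left_mono norm_cis_diff_le) auto
      also have "\<dots> = r * \<bar>\<theta>\<bar> * \<bar>t - t'\<bar>"
        by (simp add: left_diff_distrib[symmetric] abs_mult)
      also have "\<dots> \<le> 3 * norm (b - a) * \<bar>t - t'\<bar>"
        using \<theta> by (intro mult_right_mono) auto
      finally show ?thesis .
    qed
    have g01: "\<gamma> 0 = a" "\<gamma> 1 = b"
      using \<theta> by (auto simp: \<gamma>_def)
    have ab: "norm (b - a) < 2 * s"
      using a b dist_triangle_half_r[of p b "2 * s" a] by (simp add: dist_norm)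
    have "\<gamma> t \<in> Q" if "0 \<le> t" "t \<le> 1" for t
    proof -
      have "\<gamma> t \<in> sphere c r"
        using a by (simp add: \<gamma>_def dist_norm norm_mult norm_minus_commute)
      then have "\<gamma> t \<in> S"
        using schottky_sphere_subset[OF S i] by blast
      moreover have "norm (\<gamma> t - a) \<le> 3 * norm (b - a) * 1"
        using lip[of t 0] that g01 mult_left_mono[of t 1 "3 * norm (b - a)"] by simp
      then have "dist a (\<gamma> t) < 6 * s"
        using ab by (simp add: dist_norm norm_minus_commute)
      then have "dist p (\<gamma> t) < 7 * s"
        using a dist_triangle[of p "\<gamma> t" a] by simp
      ultimately show ?thesis by (simp add: Q_def)
    qed
    then have "norm (h (\<gamma> 1) - h (\<gamma> 0)) \<le> k * (3 * norm (b - a))"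
      using \<open>0 \<le> k\<close>
      by (intro mean_value_Lipschitz_path_with_gaps[OF hQ _ _ lip, of UNIV]) auto
    then show ?thesis
      by (simp add: g01)
  qed
  define \<sigma> where "\<sigma> t = x + of_real t * (y - x)" for t
  have lip: "norm (\<sigma> t - \<sigma> t') = norm (y - x) * \<bar>t - t'\<bar>" for t t'
  proof -
    have "\<sigma> t - \<sigma> t' = of_real (t - t') * (y - x)"
      by (simp add: \<sigma>_def algebra_simps)
    then show ?thesis
      by (simp only: norm_mult norm_of_real mult.commute)
  qed
  have seg: "\<sigma> t \<in> ball p s" if "0 \<le> t" "t \<le> 1" for t
  proof -
    have "\<sigma> t = (1 - t) *\<^sub>R x + t *\<^sub>R y"
      by (simp add: \<sigma>_def scaleR_conv_of_real algebra_simps)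
    then show ?thesis
      using x y that convexD_alt[OF convex_ball, of x p s y t] by auto
  qed
  define T where "T = {0..1} - \<sigma> -` (\<Union>i\<in>I. B i)"
  have "open (\<sigma> -` (\<Union>i\<in>I. B i))"
    using relative_schottky_setD(5)[OF S] unfolding \<sigma>_def
    by (intro open_vimage continuous_intros) auto
  then have clT: "closed T"
    by (auto simp: T_def)
  have TS: "t \<in> T \<longleftrightarrow> 0 \<le> t \<and> t \<le> 1 \<and> \<sigma> t \<in> S" for t
    using seg[of t] sub D by (auto simp: T_def Seq)
  have s01: "\<sigma> 0 = x" "\<sigma> 1 = y"
    by (auto simp: \<sigma>_def)
  have gap: "norm (h (\<sigma> v) - h (\<sigma> u)) \<le> 3 * k * norm (y - x) * (v - u)"
    if uv: "u \<in> T" "v \<in> T" "u < v" "{u<..<v} \<inter> T = {}" for u v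
  proof (cases "\<sigma> u = \<sigma> v")
    case True
    then show ?thesis using uv \<open>0 \<le> k\<close> by simp
  next
    case False
    have "open_segment (\<sigma> u) (\<sigma> v) \<subseteq> D - S"
    proof
      fix z assume "z \<in> open_segment (\<sigma> u) (\<sigma> v)"
      then obtain w where w: "0 < w" "w < 1" "z = (1 - w) *\<^sub>R \<sigma> u + w *\<^sub>R \<sigma> v"
        by (auto simp: in_segment)
      define t where "t = (1 - w) * u + w * v"
      have z: "z = \<sigma> t"
        by (simp add: w \<sigma>_def t_def scaleR_conv_of_real algebra_simps)
      have "t = u + w * (v - u)" "t = v - (1 - w) * (v - u)"
        by (auto simp: t_def algebra_simps)
      moreover have "0 < w * (v - u)" "0 < (1 - w) * (v - u)"
        using w uv by simp_all
      ultimately have "u < t" "t < v"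
        by linarith+
      moreover from this have "0 \<le> t" "t \<le> 1"
        using uv by (auto simp: TS)
      ultimately show "z \<in> D - S"
        using uv(4) TS[of t] seg[of t] sub D z by auto
    qed
    moreover have "\<sigma> u \<in> S" "\<sigma> v \<in> S"
      using uv by (auto simp: TS)
    ultimately obtain i c r
      where arc: "i \<in> I" "B i = ball c r" "0 < r" "\<sigma> u \<in> sphere c r" "\<sigma> v \<in> sphere c r"
      using schottky_chord[OF S _ _ False] by blast
    have "\<sigma> u \<in> ball p s" "\<sigma> v \<in> ball p s"
      using seg uv by (auto simp: TS)
    with arc have "norm (h (\<sigma> v) - h (\<sigma> u)) \<le> 3 * k * norm (\<sigma> v - \<sigma> u)"
      using circle by blast
    then show ?thesis
      using uv by (simp add: lip)
  qed
  have "norm (h (\<sigma> 1) - h (\<sigma> 0)) \<le> 3 * k * norm (y - x)"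
  proof (rule mean_value_Lipschitz_path_with_gaps[OF hQ \<open>0 \<le> k\<close> norm_ge_zero[of "y - x"] _ clT])
    show "\<sigma> t \<in> Q" if "t \<in> T" for t
      using that seg[of t] sub by (auto simp: TS Q_def)
    show "k * norm (y - x) \<le> 3 * k * norm (y - x)"
      using \<open>0 \<le> k\<close> by (simp add: mult_right_mono)
  qed (use gap x y s01 in \<open>auto simp: lip TS\<close>)
  then show ?thesis
    by (simp add: s01)
qed


section \<open>Schottky maps near a point\<close>

text \<open>
  At an isolated point of \<open>A\<close> the number \<open>schottky_deriv A f x\<close> is arbitrary, but then the filter is
  trivial and every bound holds.
\<close>

lemma schottky_deriv_bound:
  assumes f: "conformal_at A f x" and e: "e > 0"
  shows "\<forall>\<^sub>F y in at x within A.
    norm (f y - f x - schottky_deriv A f x * (y - x)) \<le> e * norm (y - x)"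
proof (cases "at x within A = bot")
  case False
  obtain l where l: "((\<lambda>q. (f q - f x) / (q - x)) \<longlongrightarrow> l) (at x within A)"
    using f unfolding conformal_at_def by blast
  then have deriv: "schottky_deriv A f x = l"
    unfolding schottky_deriv_def by (rule tendsto_Lim[OF False])
  have "\<forall>\<^sub>F y in at x within A. dist ((f y - f x) / (y - x)) l < e"
    using l e by (rule tendstoD)
  then show ?thesis
  proof eventually_elim
    case (elim y)
    show ?case
    proof (cases "y = x")
      case False
      then have "f y - f x - l * (y - x) = ((f y - f x) / (y - x) - l) * (y - x)"
        by (simp add: field_simps)
      then show ?thesis
        using elim by (simp add: deriv norm_mult dist_norm mult_right_mono)
    qed simp
  qed
qed simp

text \<open>
  The function \<open>f x - f' p * x\<close> has derivative \<open>f' x - f' p\<close> at \<open>x\<close>, which is small near \<open>p\<close> since \<open>f'\<close> is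
  continuous. The mean value inequality turns this into a small Lipschitz constant.
\<close>

lemma schottky_map_strict_derivative:
  assumes S: "relative_schottky_set D I B S" and U: "open U" "U \<subseteq> D"
    and f: "schottky_map (S \<inter> U) S' f" and p: "p \<in> S \<inter> U" and e: "e > 0"
  obtains s where "s > 0" and
    "\<And>x y. x \<in> S \<inter> ball p s \<Longrightarrow> y \<in> S \<inter> ball p s \<Longrightarrow>
      norm (f y - f x - schottky_deriv (S \<inter> U) f p * (y - x)) \<le> e * norm (y - x)"
proof -
  define A where "A = S \<inter> U"
  define l where "l = schottky_deriv A f"
  define h where "h x = f x - l p * x" for x
  have conf: "conformal_at A f x" if "x \<in> A" for x
    using f that by (simp add: schottky_map_def A_def)
  have "continuous_on A l"
    using f by (simp add: schottky_map_def A_def l_def)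
  then obtain r where r: "r > 0" "\<And>x. x \<in> A \<Longrightarrow> dist x p < r \<Longrightarrow> dist (l x) (l p) < e / 6"
    using p e unfolding continuous_on_iff A_def[symmetric] by (metis divide_pos_pos zero_less_numeral)
  obtain r' where r': "r' > 0" "ball p r' \<subseteq> U"
    using U(1) p openE by blast
  define s where "s = min r r' / 7"
  have s: "s > 0" "7 * s \<le> r" "ball p (7 * s) \<subseteq> U"
    using r(1) r' subset_ball[of "7 * s" r' p] by (auto simp: s_def)
  let ?Q = "S \<inter> ball p (7 * s)"
  have QA: "?Q \<subseteq> A"
    using s by (auto simp: A_def)
  have "\<forall>\<^sub>F y in at x within ?Q. dist (h y) (h x) \<le> e / 3 * dist y x" if x: "x \<in> ?Q" for x
  proof -
    have xA: "x \<in> A"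
      using x QA by blast
    have lx: "norm (l x - l p) \<le> e / 6"
      using r(2)[OF xA] x s(2) by (simp add: dist_norm norm_minus_commute)
    have "\<forall>\<^sub>F y in at x within A. norm (f y - f x - l x * (y - x)) \<le> e / 6 * norm (y - x)"
      unfolding l_def using e by (intro schottky_deriv_bound conf xA) simp
    then have "\<forall>\<^sub>F y in at x within ?Q. norm (f y - f x - l x * (y - x)) \<le> e / 6 * norm (y - x)"
      using at_le[OF QA] by (rule filter_leD[rotated])
    then show ?thesis
    proof eventually_elim
      case (elim y)
      have "h y - h x = (f y - f x - l x * (y - x)) + (l x - l p) * (y - x)"
        by (simp add: h_def algebra_simps)
      also have "norm \<dots> \<le> e / 6 * norm (y - x) + norm (l x - l p) * norm (y - x)"
        using elim norm_mult[of "l x - l p" "y - x"] by (intro norm_triangle_le) simp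
      also have "\<dots> \<le> e / 6 * norm (y - x) + e / 6 * norm (y - x)"
        using lx by (intro add_left_mono mult_right_mono) auto
      finally show ?case
        by (simp add: dist_norm)
    qed
  qed
  then have "pointwise_lipschitz_on (e / 3) ?Q h"
    by (simp add: pointwise_lipschitz_on_def)
  then have "norm (h y - h x) \<le> 3 * (e / 3) * norm (y - x)"
    if "x \<in> S \<inter> ball p s" "y \<in> S \<inter> ball p s" for x y
    using that s U(2) e by (intro schottky_mean_value[OF S, of p s]) auto
  moreover have "h y - h x = f y - f x - l p * (y - x)" for x y
    by (simp add: h_def algebra_simps)
  ultimately show ?thesis
    using that[OF s(1)] by (simp add: l_def A_def)
qed

lemma tendsto_schottky_deriv:
  assumes "conformal_at A f p" "at p within A \<noteq> bot"
  shows "((\<lambda>q. (f q - f p) / (q - p)) \<longlongrightarrow> schottky_deriv A f p) (at p within A)"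
    and "schottky_deriv A f p \<noteq> 0"
proof -
  obtain l where l: "l \<noteq> 0" "((\<lambda>q. (f q - f p) / (q - p)) \<longlongrightarrow> l) (at p within A)"
    using assms(1) unfolding conformal_at_def by blast
  moreover from this have "schottky_deriv A f p = l"
    unfolding schottky_deriv_def by (intro tendsto_Lim assms(2))
  ultimately show "((\<lambda>q. (f q - f p) / (q - p)) \<longlongrightarrow> schottky_deriv A f p) (at p within A)"
    "schottky_deriv A f p \<noteq> 0"
    by simp_all
qed

lemma local_homeomorphism_continuous:
  assumes "local_homeomorphism A T f" "p \<in> A"
  shows "continuous (at p within A) f"
proof -
  obtain V h where V: "open V" "p \<in> V" and h: "homeomorphism (A \<inter> V) (f ` (A \<inter> V)) f h"
    using assms unfolding local_homeomorphism_def by blast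
  have "continuous (at p within A \<inter> V) f"
    using h V assms(2) by (auto simp: homeomorphism_def continuous_on_eq_continuous_within)
  then show ?thesis
    using at_within_nhd[of p V "A \<inter> V" A] V by (auto simp: continuous_within)
qed

text \<open>
  Besides a preimage, which exists because images of small neighborhoods are open in \<open>T\<close>, this gives a
  preimage close to \<open>p\<close>, by continuity of the local inverse.
\<close>

lemma local_homeomorphism_local_preimage:
  assumes f: "local_homeomorphism A T f" and p: "p \<in> A" and s: "s > 0"
  obtains r where "r > 0" "\<And>y. y \<in> T \<Longrightarrow> dist y (f p) < r \<Longrightarrow> \<exists>x\<in>A. dist x p < s \<and> f x = y"
proof -
  obtain V h where V: "open V" "p \<in> V" and op: "openin (top_of_set T) (f ` (A \<inter> V))"
    and h: "homeomorphism (A \<inter> V) (f ` (A \<inter> V)) f h"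
    using f p unfolding local_homeomorphism_def by blast
  let ?Y = "f ` (A \<inter> V)"
  have hp: "h (f p) = p" "f p \<in> ?Y" and "continuous_on ?Y h"
    using h p V by (auto simp: homeomorphism_def)
  then obtain r where r: "r > 0" "\<And>y. y \<in> ?Y \<Longrightarrow> dist y (f p) < r \<Longrightarrow> dist (h y) p < s"
    using s unfolding continuous_on_iff by metis
  obtain r' where r': "r' > 0" "ball (f p) r' \<inter> T \<subseteq> ?Y"
    using op hp(2) unfolding openin_contains_ball by blast
  have "\<exists>x\<in>A. dist x p < s \<and> f x = y" if "y \<in> T" "dist y (f p) < min r r'" for y
  proof -
    have "y \<in> ?Y"
      using r'(2) that by (auto simp: dist_commute)
    moreover from this have "h y \<in> A" "f (h y) = y"
      using h by (auto simp: homeomorphism_def)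
    ultimately show ?thesis
      using r(2)[of y] that by auto
  qed
  with that[of "min r r'"] r(1) r'(1) show ?thesis by auto
qed

section \<open>Rigidity\<close>

lemma open_half_plane_unbounded:
  assumes "open_half_plane B"
  shows "\<not> bounded B"
proof
  assume "bounded B"
  obtain a b where a: "a \<noteq> 0" and B: "B = {z. a \<bullet> z < b}"
    using assms unfolding open_half_plane_def by blast
  obtain R where R: "\<And>z. z \<in> B \<Longrightarrow> norm z \<le> R"
    using \<open>bounded B\<close> unfolding bounded_iff by blast
  define t\<^sub>1 where "t\<^sub>1 = (\<bar>b\<bar> + 1) / (a \<bullet> a)"
  define t\<^sub>2 where "t\<^sub>2 = (\<bar>R\<bar> + 1) / norm a"
  define t where "t = t\<^sub>1 + t\<^sub>2"
  have pos: "a \<bullet> a > 0" "norm a > 0"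
    using a by auto
  have t1: "t\<^sub>1 * (a \<bullet> a) = \<bar>b\<bar> + 1" "t\<^sub>1 \<ge> 0" and t2: "t\<^sub>2 * norm a = \<bar>R\<bar> + 1" "t\<^sub>2 \<ge> 0"
    using pos by (simp_all add: t\<^sub>1_def t\<^sub>2_def)
  have "\<bar>b\<bar> + 1 \<le> t * (a \<bullet> a)"
    using t1 t2 by (simp add: t_def distrib_right)
  then have "- (t *\<^sub>R a) \<in> B"
    by (simp add: B)
  then have "norm (- (t *\<^sub>R a)) \<le> R"
    by (rule R)
  moreover have "\<bar>R\<bar> + 1 \<le> t * norm a"
    using t1 t2 by (simp add: t_def distrib_right)
  moreover have "t * norm a \<le> norm (- (t *\<^sub>R a))"
    by (simp add: mult_right_mono)
  ultimately show False by linarith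
qed


text \<open>
  The values and the difference quotients of \<open>f\<close> and \<open>g\<close> coincide along a sequence that tends to \<open>p\<close>,
  so their limits do.
\<close>

lemma agree_to_first_order:
  assumes conf: "conformal_at A f p" "conformal_at A g p"
    and cont: "(f \<longlongrightarrow> f p) (at p within A)" "(g \<longlongrightarrow> g p) (at p within A)"
    and lim: "p islimpt {q \<in> A. f q = g q}"
  shows "f p = g p" "schottky_deriv A g p = schottky_deriv A f p" "schottky_deriv A f p \<noteq> 0"
proof -
  define E where "E = {q \<in> A. f q = g q}"
  have EA: "E \<subseteq> A"
    by (auto simp: E_def)
  have nE: "at p within E \<noteq> bot"
    using lim by (simp add: E_def trivial_limit_within)
  then have nA: "at p within A \<noteq> bot"
    using at_le[OF EA, of p] by (metis bot.extremum_uniqueI)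
  have onE: "\<forall>\<^sub>F q in at p within E. f q = g q"
    by (auto simp: E_def eventually_at_filter)
  show fgp: "f p = g p"
  proof (rule tendsto_unique[OF nE])
    show "(f \<longlongrightarrow> f p) (at p within E)"
      using cont(1) EA by (rule tendsto_within_subset)
    show "(f \<longlongrightarrow> g p) (at p within E)"
      using tendsto_within_subset[OF cont(2) EA] onE by (simp cong: tendsto_cong)
  qed
  note quot = tendsto_schottky_deriv(1)[OF conf(1) nA] tendsto_schottky_deriv(1)[OF conf(2) nA]
  show "schottky_deriv A f p \<noteq> 0"
    using conf(1) nA by (rule tendsto_schottky_deriv(2))
  show "schottky_deriv A g p = schottky_deriv A f p"
  proof (rule tendsto_unique[OF nE])
    show "((\<lambda>q. (f q - f p) / (q - p)) \<longlongrightarrow> schottky_deriv A f p) (at p within E)"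
      using quot(1) EA by (rule tendsto_within_subset)
    have "\<forall>\<^sub>F q in at p within E. (g q - g p) / (q - p) = (f q - f p) / (q - p)"
      using onE by eventually_elim (simp add: fgp)
    then show "((\<lambda>q. (f q - f p) / (q - p)) \<longlongrightarrow> schottky_deriv A g p) (at p within E)"
      by (rule Lim_transform_eventually[OF tendsto_within_subset[OF quot(2) EA]])
  qed
qed

text \<open>
  If \<open>f q \<noteq> g q\<close>, the boundary point \<open>z = c + \<rho> v / |v|\<close> of a suitable hole \<open>ball c \<rho>\<close> satisfies
  \<open>g z = f x\<close> for some \<open>x \<in> S\<close>, and \<open>x\<close> is so close to \<open>z - v\<close> that it lies in the hole.
\<close>

lemma schottky_maps_agree_near:
  assumes S: "relative_schottky_set D I B S" and porous: "locally_porous_at I B S p"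
    and U: "open U" "U \<subseteq> D"
    and f: "schottky_map (S \<inter> U) T f" and g: "schottky_map (S \<inter> U) T g"
    and p: "p \<in> S \<inter> U" and lim: "p islimpt {q \<in> S \<inter> U. f q = g q}"
  shows "\<exists>s>0. \<forall>q\<in>S \<inter> U. dist q p < s \<longrightarrow> f q = g q"
proof -
  define A where "A = S \<inter> U"
  define l where "l = schottky_deriv A f p"
  have homeo: "local_homeomorphism A T f" "local_homeomorphism A T g"
    and conf: "conformal_at A f p" "conformal_at A g p"
    using f g p by (auto simp: schottky_map_def A_def)
  have cont: "(f \<longlongrightarrow> f p) (at p within A)" "(g \<longlongrightarrow> g p) (at p within A)"
    using homeo[THEN local_homeomorphism_continuous, of p] p
    by (auto simp: A_def continuous_within)
  note first_order = agree_to_first_order[OF conf cont lim[folded A_def]]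
  have fgp: "f p = g p" and lg: "schottky_deriv A g p = l" and l: "l \<noteq> 0"
    using first_order by (simp_all add: l_def)
  obtain W r0 C where W: "open W" "p \<in> W" "0 < r0" "1 \<le> C" and
    hole: "\<And>q r. q \<in> S \<inter> W \<Longrightarrow> 0 < r \<Longrightarrow> r \<le> r0 \<Longrightarrow>
      \<exists>i\<in>I. ball q r \<inter> B i \<noteq> {} \<and> bounded (B i) \<and> r / C \<le> diameter (B i) \<and> diameter (B i) \<le> C * r"
    using porous unfolding locally_porous_at_def by blast
  \<comment> \<open>The hole chosen below lies within distance \<open>M * d\<close> of \<open>q\<close>. The constant \<open>e\<close> makes the total error
    \<open>2 * e * M * d + e * (4 * d)\<close> smaller than \<open>norm l * d\<close>.\<close>
  define M where "M = 8 * C\<^sup>2"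
  define e where "e = norm l / (5 + 2 * M)"
  have M: "8 \<le> M" "4 * C + 4 * C\<^sup>2 \<le> M"
    using W(4) one_le_power[of C 2] mult_left_mono[of 1 C C] by (auto simp: M_def power2_eq_square)
  have e: "e > 0" "e * (5 + 2 * M) = norm l"
    using l M by (auto simp: e_def)
  have e': "e * (4 + 2 * M) < norm l" "2 * e \<le> norm l" "2 * e * M \<le> norm l"
  proof -
    have "0 < e * M"
      using e(1) M by simp
    then show "e * (4 + 2 * M) < norm l" "2 * e \<le> norm l" "2 * e * M \<le> norm l"
      using e M unfolding e(2)[symmetric] by (simp_all add: distrib_left)
  qed
  obtain s1 where s1: "s1 > 0" "\<And>x y. x \<in> S \<inter> ball p s1 \<Longrightarrow> y \<in> S \<inter> ball p s1 \<Longrightarrow>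
      norm (f y - f x - l * (y - x)) \<le> e * norm (y - x)"
    using schottky_map_strict_derivative[OF S U f p e(1)] unfolding l_def A_def by blast
  obtain s2 where s2: "s2 > 0" "\<And>x y. x \<in> S \<inter> ball p s2 \<Longrightarrow> y \<in> S \<inter> ball p s2 \<Longrightarrow>
      norm (g y - g x - l * (y - x)) \<le> e * norm (y - x)"
    using schottky_map_strict_derivative[OF S U g p e(1)] unfolding lg[symmetric] A_def by blast
  obtain s3 where s3: "s3 > 0" "ball p s3 \<subseteq> U \<inter> W"
    using U(1) W(1,2) p openE[of "U \<inter> W" p] by blast
  obtain \<eta> where \<eta>: "\<eta> > 0" "\<And>y. y \<in> T \<Longrightarrow> dist y (f p) < \<eta> \<Longrightarrow> \<exists>x\<in>A. dist x p < s1 \<and> f x = y"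
    using local_homeomorphism_local_preimage[OF homeo(1) _ s1(1), of p] p unfolding A_def by blast
  obtain s4 where s4: "s4 > 0" "\<And>z. z \<in> A \<Longrightarrow> dist z p < s4 \<Longrightarrow> dist (g z) (g p) < \<eta>"
  proof -
    have "continuous (at p within A) g"
      using cont(2) by (simp add: continuous_within)
    then show ?thesis
      using that \<eta>(1) unfolding continuous_within_eps_delta by blast
  qed
  define t where "t = min (min s1 s2) (min s3 s4)"
  define s where "s = min (t / (2 * (1 + M))) (r0 / (4 * C))"
  have t: "t > 0" "t \<le> s1" "t \<le> s2" "t \<le> s3" "t \<le> s4"
    using s1 s2 s3 s4 by (auto simp: t_def)
  have s: "s > 0" "s * (1 + M) < t" "4 * C * s \<le> r0"
  proof -
    show "s > 0"
      using t W M by (simp add: s_def)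
    have "s * (1 + M) \<le> t / (2 * (1 + M)) * (1 + M)"
      using M by (intro mult_right_mono) (auto simp: s_def)
    also have "\<dots> = t / 2"
      using M by (simp add: divide_simps)
    also have "\<dots> < t"
      using t(1) by simp
    finally show "s * (1 + M) < t" .
    have "4 * C * s \<le> 4 * C * (r0 / (4 * C))"
      using W(4) by (intro mult_left_mono) (auto simp: s_def)
    then show "4 * C * s \<le> r0"
      using W(4) by simp
  qed
  have st: "s < t"
    using s(1,2) M by (simp add: distrib_left) (smt (verit) mult_pos_pos)
  have diff: "norm ((f y - g y) - (f x - g x)) \<le> 2 * e * norm (y - x)"
    if "x \<in> S" "y \<in> S" "dist x p < t" "dist y p < t" for x y
  proof -
    have "(f y - g y) - (f x - g x)
        = (f y - f x - l * (y - x)) - (g y - g x - l * (y - x))"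
      by simp
    then have "norm ((f y - g y) - (f x - g x))
        \<le> norm (f y - f x - l * (y - x)) + norm (g y - g x - l * (y - x))"
      by (simp only: norm_triangle_ineq4)
    then show ?thesis
      using s1(2)[of x y] s2(2)[of x y] that t by (auto simp: dist_commute)
  qed
  have "f q = g q" if q: "q \<in> A" "dist q p < s" for q
  proof (rule ccontr)
    assume neq: "f q \<noteq> g q"
    define v where "v = (f q - g q) / l"
    define d where "d = norm v"
    have d: "d > 0"
      using neq l by (simp add: d_def v_def)
    have qS: "q \<in> S" "dist q p < t"
      using q st by (auto simp: A_def)
    have "norm (l * v) \<le> 2 * e * norm (q - p)"
      using diff[of p q] qS p t(1) l by (simp add: fgp v_def)
    also have "\<dots> \<le> norm l * norm (q - p)"
      using e' by (intro mult_right_mono) auto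
    finally have "d \<le> norm (q - p)"
      using l by (simp add: d_def norm_mult)
    then have ds: "d < s"
      using q(2) by (simp add: dist_norm)
    \<comment> \<open>Porosity on the scale \<open>4 * C * d\<close> yields a diameter of at least \<open>4 * d\<close>, so that moving inwards
      by \<open>d\<close> does not pass the center of the disc.\<close>
    obtain i where i: "i \<in> I" "ball q (4 * C * d) \<inter> B i \<noteq> {}" "bounded (B i)"
      "4 * C * d / C \<le> diameter (B i)" "diameter (B i) \<le> C * (4 * C * d)"
    proof -
      have "4 * C * d \<le> 4 * C * s"
        using ds W(4) by (intro mult_left_mono) auto
      then have "4 * C * d \<le> r0"
        using s(3) by (rule order.trans)
      moreover have "0 < 4 * C * d"
        using W(4) d by simp
      moreover have "q \<in> S \<inter> W"
        using qS t(4) s3(2) by (auto simp: dist_commute subset_iff)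
      ultimately show ?thesis
        using hole[of q "4 * C * d"] that by blast
    qed
    obtain c \<rho> where B: "B i = ball c \<rho>" "\<rho> > 0"
      using relative_schottky_setD(2)[OF S i(1)] open_half_plane_unbounded i(3)
      unfolding open_disc_def by blast
    have \<rho>: "2 * d \<le> \<rho>" "2 * \<rho> \<le> 4 * C\<^sup>2 * d"
      using i(4,5) B W(4) by (auto simp: diameter_ball power2_eq_square)
    define z where "z = c + of_real \<rho> * sgn v"
    have z: "z \<in> sphere c \<rho>"
      using B d by (simp add: z_def dist_norm norm_mult norm_sgn d_def)
    then have zS: "z \<in> S"
      using schottky_sphere_subset[OF S i(1) B] by blast
    have zq: "norm (z - q) \<le> M * d"
    proof -
      obtain b where b: "dist q b < 4 * C * d" "dist c b < \<rho>"
        using i(2) B by auto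
      have "dist q z \<le> dist q b + dist c b + dist c z"
        using dist_triangle[of q z b] dist_triangle[of b z c] by (simp add: dist_commute)
      also have "\<dots> \<le> 4 * C * d + 4 * C\<^sup>2 * d"
        using b z \<rho>(2) unfolding mem_sphere by linarith
      also have "\<dots> \<le> M * d"
        using mult_right_mono[OF M(2), of d] d by (simp add: distrib_right)
      finally show ?thesis
        by (simp add: dist_norm norm_minus_commute)
    qed
    have zt: "dist z p < t"
    proof -
      have "dist z p \<le> dist z q + dist q p"
        by (rule dist_triangle)
      also have "\<dots> < M * s + s"
      proof -
        have "M * d \<le> M * s"
          using ds M(1) by (intro mult_left_mono) auto
        then show ?thesis
          using zq q(2) unfolding dist_norm by linarith
      qed
      finally show ?thesis
        using s(2) by (simp add: algebra_simps)
    qed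
    have zA: "z \<in> A"
      using zS zt t(4) s3(2) by (auto simp: A_def dist_commute subset_iff)
    have "g z \<in> T"
      using homeo(2) zA by (auto simp: local_homeomorphism_def)
    then obtain x where x: "x \<in> A" "dist x p < s1" "f x = g z"
      using \<eta>(2)[of "g z"] s4(2)[OF zA] zt t(5) by (auto simp: fgp)
    \<comment> \<open>Deviation of \<open>f z - g z\<close> from \<open>f q - g q\<close>, and of \<open>f\<close> from its linear part between \<open>z\<close> and \<open>x\<close>.\<close>
    define err\<^sub>1 where "err\<^sub>1 = (f z - g z) - l * v"
    define err\<^sub>2 where "err\<^sub>2 = f x - f z - l * (x - z)"
    have e1: "norm err\<^sub>1 \<le> 2 * e * (M * d)"
    proof -
      have "norm err\<^sub>1 \<le> 2 * e * norm (z - q)"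
        using diff[of q z] qS zS zt l by (simp add: err\<^sub>1_def v_def)
      also have "\<dots> \<le> 2 * e * (M * d)"
        using zq e(1) by (intro mult_left_mono) auto
      finally show ?thesis .
    qed
    have e2: "norm err\<^sub>2 \<le> e * norm (x - z)"
      unfolding err\<^sub>2_def using s1(2)[of z x] x zS zt t(2) by (auto simp: A_def dist_commute)
    have main: "l * (x - z + v) = - err\<^sub>1 - err\<^sub>2"
      using x(3) by (simp add: err\<^sub>1_def err\<^sub>2_def algebra_simps)
    \<comment> \<open>The second error is bounded in terms of \<open>norm (x - z)\<close>. A crude bound on this distance comes first:
      since \<open>e \<le> norm l / 2\<close>, that error can be absorbed into the left-hand side.\<close>
    have xz: "norm (x - z) \<le> 4 * d"
    proof -
      have "l * (x - z) = - (err\<^sub>1 + (err\<^sub>2 + l * v))"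
        using main by (simp add: algebra_simps)
      then have "norm l * norm (x - z) = norm (err\<^sub>1 + (err\<^sub>2 + l * v))"
        by (metis norm_minus_cancel norm_mult)
      also have "\<dots> \<le> norm err\<^sub>1 + (norm err\<^sub>2 + norm (l * v))"
        by (intro norm_triangle_le add_left_mono norm_triangle_ineq)
      also have "\<dots> \<le> norm l * d + (norm l / 2 * norm (x - z) + norm l * d)"
      proof (intro add_mono)
        show "norm err\<^sub>1 \<le> norm l * d"
          using order.trans[OF e1, of "norm l * d"] mult_right_mono[OF e'(3), of d] d
          by (simp only: mult.assoc)
        show "norm err\<^sub>2 \<le> norm l / 2 * norm (x - z)"
          using e'(2) by (intro order.trans[OF e2] mult_right_mono) auto
      qed (simp add: norm_mult d_def)
      finally have "norm l * norm (x - z) \<le> norm l * (4 * d)"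
        by (simp add: algebra_simps)
      then show ?thesis
        using l by simp
    qed
    have small: "norm (x - z + v) < d"
    proof -
      have "norm l * norm (x - z + v) = norm (- err\<^sub>1 - err\<^sub>2)"
        by (simp only: main[symmetric] norm_mult)
      also have "\<dots> \<le> norm err\<^sub>1 + norm err\<^sub>2"
        using norm_triangle_ineq4[of "- err\<^sub>1" err\<^sub>2] by simp
      also have "\<dots> \<le> 2 * e * (M * d) + e * (4 * d)"
        using e1 e2 mult_left_mono[OF xz, of e] e(1) by linarith
      also have "\<dots> = e * (4 + 2 * M) * d"
        by (simp add: algebra_simps)
      also have "\<dots> < norm l * d"
        using e'(1) d by (rule mult_strict_right_mono)
      finally show ?thesis
        using l by simp
    qed
    \<comment> \<open>The point \<open>z - v\<close> has distance \<open>\<rho> - d\<close> from \<open>c\<close>, and \<open>x\<close> is closer to it than \<open>d\<close>.\<close>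
    have "x \<in> B i"
    proof -
      have vd: "v = of_real d * sgn v"
        using d by (simp add: d_def sgn_eq)
      have "x - c = of_real (\<rho> - d) * sgn v + (x - z + v)"
        by (subst (2) vd) (simp add: z_def algebra_simps)
      then have "norm (x - c) \<le> norm (of_real (\<rho> - d) * sgn v) + norm (x - z + v)"
        by (simp only: norm_triangle_ineq)
      also have "norm (of_real (\<rho> - d) * sgn v) = \<rho> - d"
      proof -
        have "0 \<le> \<rho> - d"
          using \<rho>(1) d by linarith
        moreover have "norm (sgn v) = 1"
          using d by (simp add: norm_sgn d_def)
        ultimately show ?thesis
          by (simp only: norm_mult norm_of_real mult_1_right abs_of_nonneg)
      qed
      finally have "norm (x - c) < \<rho>"
        using small by simp
      then show ?thesis
        by (simp add: B dist_norm norm_minus_commute)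
    qed
    then show False
      using x(1) i(1) relative_schottky_setD(1)[OF S] by (auto simp: A_def)
  qed
  then show ?thesis
    using s(1) by (auto simp: A_def)
qed

theorem corollary4p2:
  fixes D D' S S' U E :: "complex set"
    and I :: "'i set" and B :: "'i \<Rightarrow> complex set"
    and J :: "'j set" and B' :: "'j \<Rightarrow> complex set"
    and f g :: "complex \<Rightarrow> complex"
  assumes "relative_schottky_set D I B S"
    and "locally_porous I B S"
    and "open U" and "U \<subseteq> D" and "connected (S \<inter> U)"
    and "relative_schottky_set D' J B' S'"
    and "schottky_map (S \<inter> U) S' f"
    and "schottky_map (S \<inter> U) S' g"
    and "E = {p \<in> S \<inter> U. f p = g p}"
    and "\<exists>a\<in>U. a islimpt E"
  shows "E = S \<inter> U"
proof -
  define A where "A = S \<inter> U"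
  define G where "G = {p \<in> A. \<exists>s>0. \<forall>q\<in>A. dist q p < s \<longrightarrow> f q = g q}"
  have GE: "G \<subseteq> E"
    using assms(9) by (auto simp: G_def A_def)
  have limG: "p \<in> G" if "p \<in> A" "p islimpt E" for p
    using schottky_maps_agree_near[OF assms(1) _ assms(3,4,7,8), of p] assms(2) that
    unfolding locally_porous_def G_def A_def assms(9) by blast
  have "openin (top_of_set A) G"
    unfolding openin_euclidean_subtopology_iff
  proof (intro conjI ballI)
    fix p assume "p \<in> G"
    then obtain s where s: "s > 0" "\<And>q. q \<in> A \<Longrightarrow> dist q p < s \<Longrightarrow> f q = g q"
      by (auto simp: G_def)
    have "p' \<in> G" if p': "p' \<in> A" "dist p' p < s / 2" for p'
    proof -
      have "f q = g q" if "q \<in> A" "dist q p' < s / 2" for q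
        using that p' dist_triangle[of q p p'] by (intro s(2)) auto
      then show ?thesis
        using p'(1) s(1) half_gt_zero[of s] unfolding G_def by blast
    qed
    then show "\<exists>e>0. \<forall>x'\<in>A. dist x' p < e \<longrightarrow> x' \<in> G"
      using s(1) half_gt_zero[of s] by blast
  qed (auto simp: G_def)
  moreover have "closedin (top_of_set A) G"
    unfolding closedin_limpt
  proof (intro conjI allI impI)
    show "p \<in> G" if "p islimpt G \<and> p \<in> A" for p
      using that limG islimpt_subset[OF _ GE] by blast
  qed (auto simp: G_def)
  moreover have "G \<noteq> {}"
  proof -
    obtain a where a: "a \<in> U" "a islimpt E"
      using assms(10) by blast
    \<comment> \<open>\<open>S\<close> is closed in \<open>D\<close>.\<close>
    have "a \<in> S"
    proof (rule ccontr)
      assume "a \<notin> S"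
      then have aO: "a \<in> (\<Union>i\<in>I. B i)"
        using a(1) assms(4) relative_schottky_setD(1)[OF assms(1)] by blast
      moreover have "open (\<Union>i\<in>I. B i)"
        using relative_schottky_setD(5)[OF assms(1)] by blast
      ultimately obtain y where "y \<in> E" "y \<in> (\<Union>i\<in>I. B i)"
        using a(2) unfolding islimpt_def by blast
      then show False
        using assms(9) relative_schottky_setD(1)[OF assms(1)] by blast
    qed
    then show ?thesis
      using limG[of a] a by (auto simp: A_def)
  qed
  ultimately have "G = A"
    using assms(5) unfolding A_def[symmetric] connected_clopen by blast
  then show ?thesis
    using GE assms(9) by (auto simp: A_def)
qed

end
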